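(* For $m,n,r$ integers, $m,n\geq 0$ and $r\geq 1$, we have $$\frac{(2m+(n-1)r)!_r}{(2m-r)!_r}=\sum_{k=0}^n\binom{n}{k}\,\frac{(m+(k-1)r)!_r}{(m-r)!_r}\cdot\frac{(m+(n-k-1)r)!_r}{(m-r)!_r}.$$
   Context: The multifactorial numbers $n!_r$, also known as $(n,r)$-factorial numbers, are given by the recurrence relation $n!_r=n\,(n-r)!_r$ with $(1-r)!_r=\cdots=(-1)!_r=0!_r=1$. For example, $17!_5=17\cdot 12\cdot 7\cdot 2=2856$; for $r=1$ one gets the factorials, $n!_1=n!$, and for $r=2$ the double factorials, $n!_2=n!!$.
   Formalization: For m = 0 the denominators (-r)!_r are undefined (0!_r = 0·(-r)!_r would give 1 = 0); there the quotient ((k-1)r)!_r/(-r)!_r is read, by cancelling with the recurrence, as the product 0·r·2r⋯(k-1)r, with value 1 for k = 0. *)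

theory Defs
  imports Complex_Main
begin

text \<open>
  \<open>multifactorial r n\<close> is $n!_r$. For \<open>r \<ge> 1\<close> the recurrence together with its initial values
  determines $n!_r$ exactly for \<open>n > - r\<close>; the value \<open>1\<close> for \<open>n \<le> - r\<close> has no meaning.
\<close>

function multifactorial :: "int \<Rightarrow> int \<Rightarrow> int" where
  "multifactorial r n = (if r \<ge> 1 \<and> n > 0 then n * multifactorial r (n - r) else 1)"
  by pat_completeness auto
termination by (relation "measure (\<lambda>(r, n). nat n)") auto

declare multifactorial.simps [simp del]

lemma multifactorial_rec: "r \<ge> 1 \<Longrightarrow> n > 0 \<Longrightarrow> multifactorial r n = n * multifactorial r (n - r)"
  by (subst multifactorial.simps) simp

lemma multifactorial_init: "n \<le> 0 \<Longrightarrow> multifactorial r n = 1"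
  by (subst multifactorial.simps) simp

lemma "multifactorial 5 17 = 2856"
  by (simp add: multifactorial_rec multifactorial_init)

lemma multifactorial_pos: "multifactorial r n > 0"
  by (induction r n rule: multifactorial.induct) (subst multifactorial.simps, auto)

text \<open>
  The quotient $a!_r / b!_r$. If \<open>b > - r\<close> it is the literal quotient. The multifactorial has
  no value (formally, a pole) at \<open>b = - r\<close>, because $0!_r = 0 \cdot (-r)!_r$ has no solution; quotients
  with denominator $(-r)!_r$ are understood by cancelling with the recurrence, i.e. for
  \<open>a = b + k r\<close> the quotient is \<open>(b + r) (b + 2 r) \<cdots> (b + k r)\<close>. The lemma
  \<open>multifactorial_quotient_eq_prod\<close> shows that this agrees with the literal quotient
  wherever the latter exists.
\<close>

definition multifactorial_quotient :: "int \<Rightarrow> int \<Rightarrow> int \<Rightarrow> real" where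
  "multifactorial_quotient r a b =
     (if b > - r then of_int (multifactorial r a) / of_int (multifactorial r b)
      else (\<Prod>j = 1..nat ((a - b) div r). of_int (b + int j * r)))"

lemma multifactorial_shift:
  assumes "r \<ge> 1" "b > - r"
  shows "multifactorial r (b + int k * r) = multifactorial r b * (\<Prod>j = 1..k. b + int j * r)"
proof (induction k)
  case (Suc k)
  have "int k * r \<ge> 0" using assms(1) by simp
  then have "b + int (Suc k) * r > 0" using assms(2) by (simp add: algebra_simps)
  then have "multifactorial r (b + int (Suc k) * r)
      = (b + int (Suc k) * r) * multifactorial r (b + int (Suc k) * r - r)"
    using assms(1) by (rule multifactorial_rec[rotated])
  also have "b + int (Suc k) * r - r = b + int k * r" by (simp add: algebra_simps)
  finally show ?case using Suc by (simp add: algebra_simps)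
qed simp

lemma multifactorial_quotient_eq_prod:
  assumes "r \<ge> 1"
  shows "multifactorial_quotient r (b + int k * r) b = (\<Prod>j = 1..k. of_int (b + int j * r))"
proof (cases "b > - r")
  case True
  have "real_of_int (multifactorial r b) \<noteq> 0"
    using multifactorial_pos[of r b] by simp
  then show ?thesis
    using True by (simp add: multifactorial_quotient_def multifactorial_shift[OF assms True])
next
  case False
  then show ?thesis using assms by (simp add: multifactorial_quotient_def)
qed

end

theory Submission
  imports Defs
begin

text \<open>
  Cancelling the recurrence, the quotient $(x + (n-1) r)!_r / (x - r)!_r$ is the rising product
  $x (x + r) \<cdots> (x + (n-1) r)$ of \<open>n\<close> factors with step \<open>r\<close>. Taking \<open>r\<close> out of every factor
  leaves $r^n$ times the ordinary rising factorial of $x / r$, that is, a Pochhammer symbol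
  (lemma \<open>multifactorial_quotient_eq_pochhammer\<close>). Since $2m / r = m / r + m / r$ and
  $r^n = r^k r^{n-k}$, the identity is the Chu--Vandermonde convolution
  $(a + b)_n = \sum_k \binom{n}{k} (a)_k (b)_{n-k}$ at $a = b = m / r$, multiplied by $r^n$
  (\<open>pochhammer_binomial_sum\<close>).
\<close>

text \<open>
  Each factor $x + i r$ of the rising product is $r (x / r + i)$. At \<open>x = 0\<close> the denominator is
  the pole $(-r)!_r$; there the product begins with the factor \<open>0\<close>, so for \<open>n > 0\<close> both sides
  vanish.
\<close>

lemma multifactorial_quotient_eq_pochhammer:
  assumes "r \<ge> 1"
  shows "multifactorial_quotient r (x + (int n - 1) * r) (x - r)
    = of_int r ^ n * pochhammer (of_int x / of_int r) n"
proof -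
  have "multifactorial_quotient r (x + (int n - 1) * r) (x - r)
      = multifactorial_quotient r (x - r + int n * r) (x - r)"
    by (simp add: algebra_simps)
  also have "\<dots> = (\<Prod>j = 1..n. of_int (x - r + int j * r))"
    using assms by (rule multifactorial_quotient_eq_prod)
  also have "\<dots> = (\<Prod>i = 0..<n. of_int (x + int i * r))"
    by (rule prod.reindex_bij_witness[of _ Suc "\<lambda>j. j - 1"]) (auto simp: of_nat_diff algebra_simps)
  also have "\<dots> = (\<Prod>i = 0..<n. of_int r * (of_int x / of_int r + of_nat i))"
    using assms by (intro prod.cong) (auto simp: field_simps)
  also have "\<dots> = of_int r ^ n * pochhammer (of_int x / of_int r) n"
    by (simp add: prod.distrib pochhammer_prod)
  finally show ?thesis .
qed

theorem proposition3p2: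
  fixes m r :: int and n :: nat
  assumes "m \<ge> 0" and "r \<ge> 1"
  shows "multifactorial_quotient r (2 * m + (int n - 1) * r) (2 * m - r) =
    (\<Sum>k = 0..n. real (n choose k)
       * multifactorial_quotient r (m + (int k - 1) * r) (m - r)
       * multifactorial_quotient r (m + (int n - int k - 1) * r) (m - r))"
proof -
  define a :: real where "a = of_int m / of_int r"
  have "multifactorial_quotient r (2 * m + (int n - 1) * r) (2 * m - r)
      = of_int r ^ n * pochhammer (a + a) n"
    using multifactorial_quotient_eq_pochhammer[OF assms(2), of "2 * m" n]
    by (simp add: a_def)
  also have "\<dots> = (\<Sum>k = 0..n. of_int r ^ n
      * (real (n choose k) * pochhammer a k * pochhammer a (n - k)))"
    by (simp only: pochhammer_binomial_sum sum_distrib_left atMost_atLeast0)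
  also have "\<dots> = (\<Sum>k = 0..n. real (n choose k)
       * multifactorial_quotient r (m + (int k - 1) * r) (m - r)
       * multifactorial_quotient r (m + (int n - int k - 1) * r) (m - r))"
  proof (intro sum.cong refl)
    fix k assume "k \<in> {0..n}"
    then have "k \<le> n" by simp
    then have "(of_int r :: real) ^ n = of_int r ^ k * of_int r ^ (n - k)"
      by (simp flip: power_add)
    moreover have "multifactorial_quotient r (m + (int k - 1) * r) (m - r)
        = of_int r ^ k * pochhammer a k"
      unfolding a_def using assms(2) by (rule multifactorial_quotient_eq_pochhammer)
    moreover have "multifactorial_quotient r (m + (int n - int k - 1) * r) (m - r)
        = of_int r ^ (n - k) * pochhammer a (n - k)"
      using multifactorial_quotient_eq_pochhammer[OF assms(2), of m "n - k"] \<open>k \<le> n\<close>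
      by (simp add: a_def of_nat_diff)
    ultimately show "of_int r ^ n * (real (n choose k) * pochhammer a k * pochhammer a (n - k))
        = real (n choose k)
          * multifactorial_quotient r (m + (int k - 1) * r) (m - r)
          * multifactorial_quotient r (m + (int n - int k - 1) * r) (m - r)"
      by (simp only: mult_ac)
  qed
  finally show ?thesis .
qed

end
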